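(* For all nonnegative integers $p,q$ there is a bijection between the set $\mathcal{P}(p,q)$ of weighted $(p,q)$ Delannoy paths and the set of signed $(p,q)$-involutions. In particular, $\alpha_{p,q}=|\mathcal{P}(p,q)|$.
   Context: A signed $(p,q)$-involution ($p,q\ge0$, $n=p+q$) is an involution $\pi$ of $\{1,\dots,n\}$ together with a sign $+$ or $-$ on each fixed point such that (number of $+$) $-$ (number of $-$) $=p-q$; $\alpha_{p,q}$ is the number of them. A $(p,q)$ Delannoy path is a lattice path in $\mathbb{N}^2$ from $(0,0)$ to $(p,q)$ using steps $E=(1,0)$, $N=(0,1)$, $D=(1,1)$. A diagonal step from $(a,b)$ to $(a+1,b+1)$ is called a $k$-diagonal step where $k=a+b+1$. A weighted $(p,q)$ Delannoy path is a $(p,q)$ Delannoy path together with a positive integer label $m_i$ on each of its diagonal steps such that, if that step is a $k$-diagonal step, then $1\le m_i\le k-1$ (non-diagonal steps carry label $1$). $\mathcal{P}(p,q)$ denotes the set of weighted $(p,q)$ Delannoy paths.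
   Formalization: The label bound on a k-diagonal step (k = a+b+1) is taken as 1 ≤ m ≤ k instead of 1 ≤ m ≤ k−1; with k−1 the claim fails already for p = q = 1 (2 weighted paths against 3 signed involutions). *)

theory Defs
  imports Main "HOL-Combinatorics.Permutations"
begin

datatype sign = Plus | Minus

text \<open>
  A signed involution is a pair \<open>(\<pi>, s)\<close>. The involution \<open>\<pi>\<close> is extended by the identity
  outside \<open>{1..p + q}\<close>, and the sign map \<open>s\<close> is defined exactly on the fixed points in
  \<open>{1..p + q}\<close>, so that each signed involution is represented once.
\<close>

definition signed_involutions :: "nat \<Rightarrow> nat \<Rightarrow> ((nat \<Rightarrow> nat) \<times> (nat \<rightharpoonup> sign)) set" where
  "signed_involutions p q =
     {(\<pi>, s). \<pi> permutes {1..p + q} \<and> \<pi> \<circ> \<pi> = id \<and>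
              dom s = {i \<in> {1..p + q}. \<pi> i = i} \<and>
              int (card {i. s i = Some Plus}) - int (card {i. s i = Some Minus}) = int p - int q}"

definition alpha :: "nat \<Rightarrow> nat \<Rightarrow> nat" where
  "alpha p q = card (signed_involutions p q)"

datatype step = East | North | Diagonal

fun advance :: "nat \<times> nat \<Rightarrow> step \<Rightarrow> nat \<times> nat" where
  "advance (a, b) East = (a + 1, b)"
| "advance (a, b) North = (a, b + 1)"
| "advance (a, b) Diagonal = (a + 1, b + 1)"

definition path_end :: "step list \<Rightarrow> nat \<times> nat" where
  "path_end L = foldl advance (0, 0) L"

definition delannoy_paths :: "nat \<Rightarrow> nat \<Rightarrow> step list set" where
  "delannoy_paths p q = {L. path_end L = (p, q)}"

text \<open>The step with (0-based) index \<open>i\<close> of \<open>L\<close> starts at \<open>path_end (take i L)\<close>.\<close>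

definition is_diagonal_step :: "nat \<Rightarrow> step list \<Rightarrow> nat \<Rightarrow> bool" where
  "is_diagonal_step k L i \<longleftrightarrow>
     i < length L \<and> L ! i = Diagonal \<and>
     (\<exists>a b. path_end (take i L) = (a, b) \<and> k = a + b + 1)"

text \<open>
  A \<open>k\<close>-diagonal step carries a label in \<open>{1..k}\<close>. The source has the bound \<open>k - 1\<close>, which is
  off by one for its convention \<open>k = a + b + 1\<close>: the step from \<open>(0, 0)\<close> to \<open>(1, 1)\<close> would then
  admit no label, leaving 2 weighted paths to \<open>(1, 1)\<close> against 3 signed \<open>(1, 1)\<close>-involutions.
  The bound \<open>k\<close> gives such a step \<open>a + b + 1\<close> labels, one for each possible partner of the
  element \<open>a + b + 2\<close>.
\<close>

definition weighted_delannoy_paths :: "nat \<Rightarrow> nat \<Rightarrow> (step \<times> nat) list set" where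
  "weighted_delannoy_paths p q =
     {W. map fst W \<in> delannoy_paths p q \<and>
         (\<forall>i < length W. fst (W ! i) \<noteq> Diagonal \<longrightarrow> snd (W ! i) = 1) \<and>
         (\<forall>i < length W. \<forall>k. is_diagonal_step k (map fst W) i \<longrightarrow>
            1 \<le> snd (W ! i) \<and> snd (W ! i) \<le> k)}"

end

theory Submission imports Defs begin

text \<open>
  Put \<open>n = p + q\<close> and \<open>d = p - q\<close>. Deleting a chosen element \<open>x\<close> of the ground set from a signed
  involution (a positive fixed point, a negative fixed point, or one half of a 2-cycle with one of
  \<open>n - 1\<close> partners) and deleting the last step of a weighted path (east, north, or diagonal with
  one of \<open>n - 1\<close> labels) lead to the same recurrence in \<open>n\<close> and \<open>d\<close>.
\<close>

section \<open>The common recurrence in size and signature\<close>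

text \<open>Indexing by the integer difference \<open>d\<close> instead of \<open>(p, q)\<close>
  spares the recurrence any boundary cases. Among \<open>Suc n\<close> elements a chosen one has
  \<open>n\<close> possible partners, and \<open>n - 1\<close> elements remain once both are
  removed; for \<open>n = 0\<close> the factor \<open>n\<close> makes the truncated subtraction
  harmless.\<close>

fun delannoy_count :: "nat \<Rightarrow> int \<Rightarrow> nat" where
  "delannoy_count 0 d = (if d = 0 then 1 else 0)"
| "delannoy_count (Suc n) d =
     delannoy_count n (d - 1) + delannoy_count n (d + 1) + n * delannoy_count (n - 1) d"

text \<open>Lowering the size by one moves \<open>d\<close> by one, and lowering it by two leaves
  \<open>d\<close> alone, so \<open>d\<close> stays out of range down to size 0. This supplies the
  zero terms for endpoints on an axis, where some last steps are impossible.\<close>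

lemma delannoy_count_eq_0: "int n < \<bar>d\<bar> \<Longrightarrow> delannoy_count n d = 0"
proof (induction n d rule: delannoy_count.induct)
  case (2 n d)
  then show ?case by (cases n) auto
qed auto

subsection \<open>Signed involutions of a finite set\<close>

text \<open>
  Working over an arbitrary finite ground set \<open>A\<close> avoids relabelling after a 2-cycle is deleted.
\<close>

definition signature :: "('a \<rightharpoonup> sign) \<Rightarrow> int" where
  "signature s = int (card {i. s i = Some Plus}) - int (card {i. s i = Some Minus})"

definition signed_involutions_on :: "'a set \<Rightarrow> int \<Rightarrow> (('a \<Rightarrow> 'a) \<times> ('a \<rightharpoonup> sign)) set" where
  "signed_involutions_on A d =
     {(\<pi>, s). \<pi> permutes A \<and> \<pi> \<circ> \<pi> = id \<and> dom s = {i \<in> A. \<pi> i = i} \<and> signature s = d}"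

lemma signed_involutions_eq:
  "signed_involutions p q = signed_involutions_on {1..p + q} (int p - int q)"
  by (simp add: signed_involutions_def signed_involutions_on_def signature_def)

lemma signature_upd:
  assumes "finite (dom s)" "x \<notin> dom s"
  shows "signature (s(x \<mapsto> Plus)) = signature s + 1" "signature (s(x \<mapsto> Minus)) = signature s - 1"
proof -
  have fin: "finite {i. s i = Some t}" for t
    by (rule finite_subset[OF _ assms(1)]) auto
  have nx: "s x = None"
    using assms(2) by auto
  have ins: "{i. (s(x \<mapsto> t)) i = Some t} = insert x {i. s i = Some t}" for t
    by auto
  have same: "{i. (s(x \<mapsto> t)) i = Some u} = {i. s i = Some u}" if "t \<noteq> u" for t u
    using that nx by auto
  show "signature (s(x \<mapsto> Plus)) = signature s + 1"
    unfolding signature_def ins using fin nx same[of Plus Minus] by simp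
  show "signature (s(x \<mapsto> Minus)) = signature s - 1"
    unfolding signature_def ins using fin nx same[of Minus Plus] by simp
qed

section \<open>Building signed involutions by adjoining an element\<close>

lemma signed_involutions_on_empty:
  "signed_involutions_on {} d = (if d = 0 then {(id, Map.empty)} else {})"
  by (auto simp: signed_involutions_on_def signature_def)

text \<open>A permutation of \<open>A\<close> already fixes \<open>x\<close>, so only the sign at
  \<open>x\<close> is added or erased. The pair \<open>(t, e)\<close> stands for
  \<open>(Plus, 1)\<close> or \<open>(Minus, -1)\<close>, which treats both signs at once.\<close>

lemma bij_betw_insert_fixed_point:
  assumes "finite A" "x \<notin> A" "\<And>s. finite (dom s) \<Longrightarrow> x \<notin> dom s \<Longrightarrow> signature (s(x \<mapsto> t)) = signature s + e"
  shows "bij_betw (\<lambda>(\<pi>, s). (\<pi>, s(x \<mapsto> t))) (signed_involutions_on A (d - e))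
           {(\<pi>, s) \<in> signed_involutions_on (insert x A) d. \<pi> x = x \<and> s x = Some t}"
proof (rule bij_betw_byWitness[where f' = "\<lambda>(\<pi>, s). (\<pi>, s(x := None))"])
  show "\<forall>a\<in>signed_involutions_on A (d - e).
          (case case a of (\<pi>, s) \<Rightarrow> (\<pi>, s(x \<mapsto> t)) of (\<pi>, s) \<Rightarrow> (\<pi>, s(x := None))) = a"
    using \<open>x \<notin> A\<close> by (auto simp: signed_involutions_on_def fun_eq_iff dom_def)
  show "\<forall>a\<in>{(\<pi>, s) \<in> signed_involutions_on (insert x A) d. \<pi> x = x \<and> s x = Some t}.
          (case case a of (\<pi>, s) \<Rightarrow> (\<pi>, s(x := None)) of (\<pi>, s) \<Rightarrow> (\<pi>, s(x \<mapsto> t))) = a"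
    by (auto simp: fun_eq_iff)
  show "(\<lambda>(\<pi>, s). (\<pi>, s(x \<mapsto> t))) ` signed_involutions_on A (d - e)
          \<subseteq> {(\<pi>, s) \<in> signed_involutions_on (insert x A) d. \<pi> x = x \<and> s x = Some t}"
  proof clarify
    fix \<pi> s
    assume "(\<pi>, s) \<in> signed_involutions_on A (d - e)"
    then have p: "\<pi> permutes A" "\<pi> \<circ> \<pi> = id" "dom s = {i \<in> A. \<pi> i = i}" "signature s = d - e"
      by (auto simp: signed_involutions_on_def)
    have "\<pi> x = x"
      using p(1) \<open>x \<notin> A\<close> by (simp add: permutes_not_in)
    moreover have "\<pi> permutes insert x A"
      using p(1) by (rule permutes_subset) auto
    moreover have "signature (s(x \<mapsto> t)) = d"
      using assms p(3,4) by simp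
    ultimately show "(\<pi>, s(x \<mapsto> t)) \<in> signed_involutions_on (insert x A) d \<and>
        \<pi> x = x \<and> (s(x \<mapsto> t)) x = Some t"
      using p by (auto simp: signed_involutions_on_def)
  qed
  show "(\<lambda>(\<pi>, s). (\<pi>, s(x := None))) `
          {(\<pi>, s) \<in> signed_involutions_on (insert x A) d. \<pi> x = x \<and> s x = Some t}
          \<subseteq> signed_involutions_on A (d - e)"
  proof clarify
    fix \<pi> s
    assume "(\<pi>, s) \<in> signed_involutions_on (insert x A) d" and fx: "\<pi> x = x" "s x = Some t"
    then have p: "\<pi> permutes insert x A" "\<pi> \<circ> \<pi> = id" "dom s = {i \<in> insert x A. \<pi> i = i}"
      "signature s = d"
      by (auto simp: signed_involutions_on_def)
    have "\<pi> permutes A"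
      using permutes_superset[OF p(1), of A] fx by auto
    have dom: "dom (s(x := None)) = {i \<in> A. \<pi> i = i}"
      using p(3) \<open>x \<notin> A\<close> by auto
    \<comment> \<open>The hypothesis on signatures speaks of adding a sign, so \<open>s\<close> is
      presented as an extension of its erasure.\<close>
    have "s = (s(x := None))(x \<mapsto> t)"
      using fx by (auto simp: fun_eq_iff)
    moreover have "finite (dom (s(x := None)))"
      unfolding dom using assms(1) by simp
    ultimately have "signature s = signature (s(x := None)) + e"
      using assms(3)[of "s(x := None)"] by (metis domIff fun_upd_same)
    with \<open>\<pi> permutes A\<close> dom show "(\<pi>, s(x := None)) \<in> signed_involutions_on A (d - e)"
      using p by (simp add: signed_involutions_on_def)
  qed
qed

text \<open>Before the composition \<open>x\<close> and \<open>j\<close> lie outside the ground set,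
  afterwards they form a 2-cycle; either way they carry no sign, so \<open>s\<close> and its
  signature are unchanged. The transposition is its own inverse, so one map serves in both
  directions.\<close>

lemma bij_betw_insert_2_cycle:
  assumes "x \<notin> A" "j \<in> A"
  shows "bij_betw (\<lambda>(\<pi>, s). (\<pi> \<circ> transpose x j, s)) (signed_involutions_on (A - {j}) d)
           {(\<pi>, s) \<in> signed_involutions_on (insert x A) d. \<pi> x = j}"
proof (rule bij_betw_byWitness[where f' = "\<lambda>(\<pi>, s). (\<pi> \<circ> transpose x j, s)"])
  have xj: "x \<noteq> j"
    using assms by auto
  show "\<forall>a\<in>signed_involutions_on (A - {j}) d.
          (case case a of (\<pi>, s) \<Rightarrow> (\<pi> \<circ> transpose x j, s) of
             (\<pi>, s) \<Rightarrow> (\<pi> \<circ> transpose x j, s)) = a"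
    by (auto simp: o_assoc[symmetric])
  show "\<forall>a\<in>{(\<pi>, s) \<in> signed_involutions_on (insert x A) d. \<pi> x = j}.
          (case case a of (\<pi>, s) \<Rightarrow> (\<pi> \<circ> transpose x j, s) of
             (\<pi>, s) \<Rightarrow> (\<pi> \<circ> transpose x j, s)) = a"
    by (auto simp: o_assoc[symmetric])
  show "(\<lambda>(\<pi>, s). (\<pi> \<circ> transpose x j, s)) ` signed_involutions_on (A - {j}) d
          \<subseteq> {(\<pi>, s) \<in> signed_involutions_on (insert x A) d. \<pi> x = j}"
  proof clarify
    fix \<pi> s
    assume "(\<pi>, s) \<in> signed_involutions_on (A - {j}) d"
    then have p: "\<pi> permutes (A - {j})" "\<pi> \<circ> \<pi> = id" "dom s = {i \<in> A - {j}. \<pi> i = i}"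
      "signature s = d"
      by (auto simp: signed_involutions_on_def)
    have fix_xj: "\<pi> x = x" "\<pi> j = j"
      using p(1) \<open>x \<notin> A\<close> by (simp_all add: permutes_not_in)
    have inv: "\<pi> (\<pi> i) = i" for i
      using p(2) by (metis comp_apply id_apply)
    let ?\<rho> = "\<pi> \<circ> transpose x j"
    have rho: "?\<rho> i = (if i = x then j else if i = j then x else \<pi> i)" for i
      using fix_xj by (simp add: transpose_def)
    have "\<pi> permutes insert x A"
      using p(1) by (rule permutes_subset) auto
    then have "?\<rho> permutes insert x A"
      using permutes_compose[of "transpose x j" "insert x A" \<pi>] permutes_swap_id[of x "insert x A" j]
        \<open>j \<in> A\<close> by simp
    \<comment> \<open>For \<open>i\<close> other than \<open>x\<close> and \<open>j\<close>,
      \<open>\<pi> i\<close> avoids both as well: \<open>\<pi> i = x\<close> would give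
      \<open>i = \<pi> x = x\<close>, and likewise for \<open>j\<close>.\<close>
    moreover have "?\<rho> (?\<rho> i) = i" for i
      unfolding rho using inv[of i] fix_xj by (smt (verit, best) inv)
    then have "?\<rho> \<circ> ?\<rho> = id"
      by (intro ext) simp
    moreover have "{i \<in> insert x A. ?\<rho> i = i} = {i \<in> A - {j}. \<pi> i = i}"
      unfolding rho using xj assms by auto
    ultimately show "(?\<rho>, s) \<in> signed_involutions_on (insert x A) d \<and> ?\<rho> x = j"
      using p rho[of x] by (simp add: signed_involutions_on_def)
  qed
  show "(\<lambda>(\<pi>, s). (\<pi> \<circ> transpose x j, s)) `
          {(\<pi>, s) \<in> signed_involutions_on (insert x A) d. \<pi> x = j}
          \<subseteq> signed_involutions_on (A - {j}) d"
  proof clarify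
    fix \<pi> s
    assume "(\<pi>, s) \<in> signed_involutions_on (insert x A) d" and j: "j = \<pi> x"
    then have p: "\<pi> permutes (insert x A)" "\<pi> \<circ> \<pi> = id" "dom s = {i \<in> insert x A. \<pi> i = i}"
      "signature s = d"
      by (auto simp: signed_involutions_on_def)
    have inv: "\<pi> (\<pi> i) = i" for i
      using p(2) by (metis comp_apply id_apply)
    have swap_xj: "\<pi> x = j" "\<pi> j = x"
      using j inv[of x] by simp_all
    let ?\<rho> = "\<pi> \<circ> transpose x j"
    have rho: "?\<rho> i = (if i = x then x else if i = j then j else \<pi> i)" for i
      using swap_xj by (simp add: transpose_def)
    have "?\<rho> permutes insert x A"
      using permutes_compose[OF _ p(1)] permutes_swap_id[of x "insert x A" j] \<open>j \<in> A\<close> by simp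
    \<comment> \<open>\<open>x\<close> and \<open>j\<close> are the only elements of
      \<open>insert x A\<close> outside \<open>A - {j}\<close>, and \<open>?\<rho>\<close> fixes
      both.\<close>
    then have "?\<rho> permutes (A - {j})"
      by (rule permutes_superset) (auto simp: rho simp del: o_apply)
    \<comment> \<open>Here \<open>\<pi> i = x\<close> would force \<open>i = j\<close>, and
      \<open>\<pi> i = j\<close> would force \<open>i = x\<close>.\<close>
    moreover have "?\<rho> (?\<rho> i) = i" for i
      unfolding rho using inv[of i] swap_xj by (smt (verit, best) inv)
    then have "?\<rho> \<circ> ?\<rho> = id"
      by (intro ext) simp
    moreover have "{i \<in> insert x A. \<pi> i = i} = {i \<in> A - {j}. ?\<rho> i = i}"
      unfolding rho using xj assms swap_xj by auto
    ultimately show "(\<pi> \<circ> transpose x (\<pi> x), s) \<in> signed_involutions_on (A - {\<pi> x}) d"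
      using p unfolding j[symmetric] by (simp add: signed_involutions_on_def)
  qed
qed

text \<open>A fixed \<open>x\<close> lies in \<open>dom s\<close> and so has a sign; a moved
  \<open>x\<close> must land in \<open>A\<close>, as \<open>\<pi>\<close> preserves the ground
  set.\<close>

lemma signed_involutions_on_insert:
  "signed_involutions_on (insert x A) d =
     {(\<pi>, s) \<in> signed_involutions_on (insert x A) d. \<pi> x = x \<and> s x = Some Plus} \<union>
     {(\<pi>, s) \<in> signed_involutions_on (insert x A) d. \<pi> x = x \<and> s x = Some Minus} \<union>
     (\<Union>j\<in>A. {(\<pi>, s) \<in> signed_involutions_on (insert x A) d. \<pi> x = j})"
  (is "?S = ?P \<union> ?M \<union> ?C")
proof
  show "?S \<subseteq> ?P \<union> ?M \<union> ?C"
  proof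
    fix z
    assume z: "z \<in> ?S"
    obtain \<pi> s where [simp]: "z = (\<pi>, s)"
      by fastforce
    have mem: "\<pi> x \<in> insert x A"
      using z permutes_in_image[of \<pi> "insert x A" x] by (simp add: signed_involutions_on_def)
    show "z \<in> ?P \<union> ?M \<union> ?C"
    proof (cases "\<pi> x = x")
      case True
      then have "x \<in> dom s"
        using z by (simp add: signed_involutions_on_def)
      then obtain t where "s x = Some t"
        by auto
      then show ?thesis
        using z True by (cases t) auto
    next
      case False
      then show ?thesis
        using z mem by auto
    qed
  qed
qed auto

text \<open>The induction is strong because deleting a 2-cycle removes two elements. Finiteness is
  proved alongside, since additivity of \<open>card\<close> over disjoint unions depends on
  it.\<close>

lemma card_signed_involutions_on:
  assumes "finite A"
  shows "finite (signed_involutions_on A d) \<and>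
         card (signed_involutions_on A d) = delannoy_count (card A) d"
  using assms
proof (induction "card A" arbitrary: A d rule: less_induct)
  case less
  show ?case
  proof (cases "A = {}")
    case True
    then show ?thesis by (simp add: signed_involutions_on_empty)
  next
    case False
    then obtain x B where A: "A = insert x B" "x \<notin> B"
      by (metis ex_in_conv mk_disjoint_insert)
    then have fB: "finite B" and cA: "card A = Suc (card B)"
      using less.prems by auto
    let ?P = "{(\<pi>, s) \<in> signed_involutions_on A d. \<pi> x = x \<and> s x = Some Plus}"
    let ?M = "{(\<pi>, s) \<in> signed_involutions_on A d. \<pi> x = x \<and> s x = Some Minus}"
    let ?C = "\<lambda>j. {(\<pi>, s) \<in> signed_involutions_on A d. \<pi> x = j}"
    note IH = less.hyps[of B, OF _ fB, unfolded cA, simplified]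
    have bP: "bij_betw (\<lambda>(\<pi>, s). (\<pi>, s(x \<mapsto> Plus))) (signed_involutions_on B (d - 1)) ?P"
      unfolding A by (rule bij_betw_insert_fixed_point[OF fB A(2)]) (rule signature_upd)
    \<comment> \<open>The form \<open>d - (- 1)\<close> matches \<open>d - e\<close> with
      \<open>e = -1\<close>.\<close>
    have bM: "bij_betw (\<lambda>(\<pi>, s). (\<pi>, s(x \<mapsto> Minus))) (signed_involutions_on B (d - (- 1))) ?M"
      unfolding A by (rule bij_betw_insert_fixed_point[OF fB A(2)]) (simp add: signature_upd)
    have P: "finite ?P" "card ?P = delannoy_count (card B) (d - 1)"
      using bij_betw_finite[OF bP] bij_betw_same_card[OF bP] IH by auto
    have M: "finite ?M" "card ?M = delannoy_count (card B) (d + 1)"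
      using bij_betw_finite[OF bM] bij_betw_same_card[OF bM] IH by auto
    have C: "finite (?C j) \<and> card (?C j) = delannoy_count (card B - 1) d" if "j \<in> B" for j
    proof -
      have b: "bij_betw (\<lambda>(\<pi>, s). (\<pi> \<circ> transpose x j, s)) (signed_involutions_on (B - {j}) d) (?C j)"
        unfolding A by (rule bij_betw_insert_2_cycle[OF A(2) that])
      show ?thesis
        using bij_betw_finite[OF b] bij_betw_same_card[OF b] less.hyps[of "B - {j}" d] that fB cA
        by simp
    qed
    have S: "signed_involutions_on A d = ?P \<union> ?M \<union> (\<Union>j\<in>B. ?C j)"
      unfolding A by (rule signed_involutions_on_insert)
    \<comment> \<open>The value \<open>\<pi> x\<close> determines \<open>j\<close>, so the pieces
      are disjoint.\<close>
    have "card (\<Union>j\<in>B. ?C j) = (\<Sum>j\<in>B. card (?C j))"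
      using C fB by (intro card_UN_disjoint) auto
    then have cC: "card (\<Union>j\<in>B. ?C j) = card B * delannoy_count (card B - 1) d"
      using C by simp
    have fC: "finite (\<Union>j\<in>B. ?C j)"
      using C fB by auto
    \<comment> \<open>Since \<open>x\<close> is not in \<open>B\<close>, no involution both fixes
      \<open>x\<close> and sends it into \<open>B\<close>.\<close>
    have "card (signed_involutions_on A d) = card (?P \<union> ?M) + card (\<Union>j\<in>B. ?C j)"
      by (subst S, rule card_Un_disjoint) (use P M fC A(2) in auto)
    also have "card (?P \<union> ?M) = card ?P + card ?M"
      by (rule card_Un_disjoint) (use P M in auto)
    finally have "card (signed_involutions_on A d) = delannoy_count (card A) d"
      using P M cC cA by simp
    moreover have "finite (signed_involutions_on A d)"
      by (subst S) (use P M fC in blast)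
    ultimately show ?thesis by blast
  qed
qed

subsection \<open>Weighted Delannoy paths\<close>

lemma path_end_Nil: "path_end [] = (0, 0)"
  by (simp add: path_end_def)

lemma path_end_snoc: "path_end (L @ [t]) = advance (path_end L) t"
  by (simp add: path_end_def)

section \<open>Decomposing weighted paths by the last step\<close>

lemma Nil_in_weighted_delannoy_paths: "[] \<in> weighted_delannoy_paths p q \<longleftrightarrow> p = 0 \<and> q = 0"
  by (auto simp: weighted_delannoy_paths_def delannoy_paths_def path_end_Nil)

text \<open>The labels allowed on a step depend only on the part of the path before it, so appending
  a step leaves all earlier conditions intact. The witness \<open>(a, b)\<close> is the endpoint of
  \<open>W\<close>.\<close>

lemma snoc_in_weighted_delannoy_paths:
  "W @ [(t, m)] \<in> weighted_delannoy_paths p q \<longleftrightarrow>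
     (\<exists>a b. W \<in> weighted_delannoy_paths a b \<and> advance (a, b) t = (p, q) \<and>
        (if t = Diagonal then m \<in> {1..a + b + 1} else m = 1))"
proof -
  obtain a b where ab: "path_end (map fst W) = (a, b)"
    by fastforce
  have diag: "is_diagonal_step k (map fst (W @ [(t, m)])) i \<longleftrightarrow>
      (if i < length W then is_diagonal_step k (map fst W) i
       else i = length W \<and> t = Diagonal \<and> k = a + b + 1)" for k i
    using ab by (auto simp: is_diagonal_step_def nth_append)
  have "(\<forall>i<length (W @ [(t, m)]). fst ((W @ [(t, m)]) ! i) \<noteq> Diagonal \<longrightarrow> snd ((W @ [(t, m)]) ! i) = 1)
      \<longleftrightarrow> (\<forall>i<length W. fst (W ! i) \<noteq> Diagonal \<longrightarrow> snd (W ! i) = 1) \<and> (t \<noteq> Diagonal \<longrightarrow> m = 1)"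
    by (auto simp: nth_append less_Suc_eq)
  moreover have "(\<forall>i<length (W @ [(t, m)]). \<forall>k. is_diagonal_step k (map fst (W @ [(t, m)])) i \<longrightarrow>
        1 \<le> snd ((W @ [(t, m)]) ! i) \<and> snd ((W @ [(t, m)]) ! i) \<le> k)
      \<longleftrightarrow> (\<forall>i<length W. \<forall>k. is_diagonal_step k (map fst W) i \<longrightarrow> 1 \<le> snd (W ! i) \<and> snd (W ! i) \<le> k)
        \<and> (t = Diagonal \<longrightarrow> 1 \<le> m \<and> m \<le> a + b + 1)"
    unfolding diag by (auto simp: nth_append less_Suc_eq)
  ultimately show ?thesis
    using ab by (auto simp: weighted_delannoy_paths_def delannoy_paths_def path_end_snoc)
qed

text \<open>The guard is needed because \<open>p - 1\<close> truncates: for \<open>p = 0\<close> an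
  appended east step would end at \<open>(1, q)\<close>.\<close>

definition east_ending :: "nat \<Rightarrow> nat \<Rightarrow> (step \<times> nat) list set" where
  "east_ending p q =
     (if p = 0 then {} else (\<lambda>W. W @ [(East, 1)]) ` weighted_delannoy_paths (p - 1) q)"

definition north_ending :: "nat \<Rightarrow> nat \<Rightarrow> (step \<times> nat) list set" where
  "north_ending p q =
     (if q = 0 then {} else (\<lambda>W. W @ [(North, 1)]) ` weighted_delannoy_paths p (q - 1))"

text \<open>The last step starts at \<open>(p - 1, q - 1)\<close>, so its label bound
  \<open>a + b + 1\<close> becomes \<open>p + q - 1\<close>.\<close>

definition diagonal_ending :: "nat \<Rightarrow> nat \<Rightarrow> (step \<times> nat) list set" where
  "diagonal_ending p q =
     (if p = 0 \<or> q = 0 then {}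
      else (\<lambda>(W, m). W @ [(Diagonal, m)]) ` (weighted_delannoy_paths (p - 1) (q - 1) \<times> {1..p + q - 1}))"

lemma weighted_delannoy_paths_rec:
  assumes "p + q > 0"
  shows "weighted_delannoy_paths p q = east_ending p q \<union> north_ending p q \<union> diagonal_ending p q"
proof (intro set_eqI)
  fix W
  show "W \<in> weighted_delannoy_paths p q \<longleftrightarrow> W \<in> east_ending p q \<union> north_ending p q \<union> diagonal_ending p q"
  proof (cases W rule: rev_cases)
    case Nil
    then show ?thesis
      using assms
      by (auto simp: Nil_in_weighted_delannoy_paths east_ending_def north_ending_def diagonal_ending_def)
  next
    case (snoc V z)
    obtain t m where z: "z = (t, m)"
      by fastforce
    show ?thesis
      unfolding snoc z snoc_in_weighted_delannoy_paths east_ending_def north_ending_def diagonal_ending_def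
      by (cases t; cases p; cases q) (auto simp: image_iff)
  qed
qed

lemma weighted_delannoy_paths_0_0: "weighted_delannoy_paths 0 0 = {[]}"
proof (intro set_eqI)
  fix W
  show "W \<in> weighted_delannoy_paths 0 0 \<longleftrightarrow> W \<in> {[]}"
  proof (cases W rule: rev_cases)
    case Nil
    then show ?thesis by (simp add: Nil_in_weighted_delannoy_paths)
  next
    case (snoc V z)
    obtain t m where z: "z = (t, m)"
      by fastforce
    show ?thesis
      unfolding snoc z snoc_in_weighted_delannoy_paths by (cases t) auto
  qed
qed

text \<open>Removing an east, north or diagonal step changes \<open>int p - int q\<close> by -1, +1
  or 0, which gives the three terms of the recurrence. A diagonal step lowers \<open>p + q\<close>
  by two, hence the strong induction.\<close>

lemma card_weighted_delannoy_paths: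
  "finite (weighted_delannoy_paths p q) \<and>
   card (weighted_delannoy_paths p q) = delannoy_count (p + q) (int p - int q)"
proof (induction "p + q" arbitrary: p q rule: less_induct)
  case less
  show ?case
  proof (cases "p + q")
    case 0
    then show ?thesis by (simp add: weighted_delannoy_paths_0_0)
  next
    case (Suc n)
    have E: "finite (east_ending p q)" "card (east_ending p q) = delannoy_count n (int p - int q - 1)"
    proof -
      \<comment> \<open>If \<open>p = 0\<close> then \<open>q = Suc n\<close>, so the shifted
        difference has absolute value \<open>n + 2\<close> and the term vanishes.\<close>
      consider "p = 0" "n < q" | p' where "p = Suc p'" "n = p' + q"
        using Suc by (cases p) auto
      then have "finite (east_ending p q) \<and> card (east_ending p q) = delannoy_count n (int p - int q - 1)"
      proof cases
        case 1
        then show ?thesis by (simp add: east_ending_def delannoy_count_eq_0)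
      next
        case 2
        then show ?thesis
          using less[of p' q] by (simp add: east_ending_def card_image inj_on_def algebra_simps)
      qed
      then show "finite (east_ending p q)"
        "card (east_ending p q) = delannoy_count n (int p - int q - 1)" by auto
    qed
    have N: "finite (north_ending p q)" "card (north_ending p q) = delannoy_count n (int p - int q + 1)"
    proof -
      consider "q = 0" "n < p" | q' where "q = Suc q'" "n = p + q'"
        using Suc by (cases q) auto
      then have "finite (north_ending p q) \<and> card (north_ending p q) = delannoy_count n (int p - int q + 1)"
      proof cases
        case 1
        then show ?thesis by (simp add: north_ending_def delannoy_count_eq_0)
      next
        case 2
        then show ?thesis
          using less[of p q'] by (simp add: north_ending_def card_image inj_on_def algebra_simps)
      qed
      then show "finite (north_ending p q)"
        "card (north_ending p q) = delannoy_count n (int p - int q + 1)" by auto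
    qed
    have D: "finite (diagonal_ending p q)"
      "card (diagonal_ending p q) = n * delannoy_count (n - 1) (int p - int q)"
    proof -
      consider "p = 0 \<or> q = 0" | p' q' where "p = Suc p'" "q = Suc q'" "n = Suc (p' + q')"
        using Suc by (cases p; cases q) auto
      then have "finite (diagonal_ending p q) \<and>
          card (diagonal_ending p q) = n * delannoy_count (n - 1) (int p - int q)"
      proof cases
        case 1
        \<comment> \<open>On an axis the difference has absolute value \<open>Suc n\<close>, too
          large for size \<open>n - 1\<close>; for \<open>n = 0\<close> the factor \<open>n\<close>
          is already zero.\<close>
        moreover have "n = 0 \<or> delannoy_count (n - 1) (int p - int q) = 0"
          using 1 Suc by (cases n) (auto intro!: delannoy_count_eq_0)
        ultimately show ?thesis by (auto simp: diagonal_ending_def)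
      next
        case 2
        \<comment> \<open>Prefix and label can be read off the list, so the count is a product; the
          label range \<open>{1..p + q - 1}\<close> is \<open>{1..n}\<close>.\<close>
        have "inj_on (\<lambda>(W, m). W @ [(Diagonal, m)]) X" for X :: "((step \<times> nat) list \<times> nat) set"
          by (auto simp: inj_on_def)
        then show ?thesis
          using less[of p' q'] 2
          by (simp add: diagonal_ending_def card_image card_cartesian_product mult.commute)
      qed
      then show "finite (diagonal_ending p q)"
        "card (diagonal_ending p q) = n * delannoy_count (n - 1) (int p - int q)" by auto
    qed
    have W: "weighted_delannoy_paths p q = east_ending p q \<union> north_ending p q \<union> diagonal_ending p q"
      using Suc by (intro weighted_delannoy_paths_rec) simp
    \<comment> \<open>Disjointness holds because the lists end in different kinds of steps.\<close>
    have "card (weighted_delannoy_paths p q) = card (east_ending p q \<union> north_ending p q) + card (diagonal_ending p q)"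
      unfolding W by (rule card_Un_disjoint)
        (use E N D in \<open>auto simp: east_ending_def north_ending_def diagonal_ending_def split: if_splits\<close>)
    also have "card (east_ending p q \<union> north_ending p q) = card (east_ending p q) + card (north_ending p q)"
      by (rule card_Un_disjoint)
        (use E N in \<open>auto simp: east_ending_def north_ending_def split: if_splits\<close>)
    finally show ?thesis
      using E N D Suc W by simp
  qed
qed

section \<open>Comparison of the two counts\<close>

theorem theorem6p2:
  fixes p q :: nat
  shows "(\<exists>f. bij_betw f (weighted_delannoy_paths p q) (signed_involutions p q)) \<and>
         alpha p q = card (weighted_delannoy_paths p q)"
proof -
  have "finite (signed_involutions p q)"
    and c: "card (signed_involutions p q) = card (weighted_delannoy_paths p q)"
    using card_signed_involutions_on[of "{1..p + q}" "int p - int q"]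
    by (simp_all add: signed_involutions_eq card_weighted_delannoy_paths)
  \<comment> \<open>The bijection is not constructed: it exists because both sets are finite and
    have the same size.\<close>
  then show ?thesis
    using card_weighted_delannoy_paths[of p q] by (simp add: alpha_def finite_same_card_bij)
qed

end
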